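(* Let $X$ be a proper geodesic metric space. Then every geodesic ray $g$ in $X$ converges (in $X_{QG}$) to a point of the quasi-geodesic boundary $\partial_{QG}X$. Moreover, if $x_0\in X$ and $p\in\partial_{QG}X$, then there is a geodesic ray in $X$ starting at $x_0$ and converging to $p$ in $X_{QG}$.
   Context: $Z_+$ is the set of positive integers. For $q\ge 1$, $Q\ge 0$, an integral $(q,Q)$-quasi-geodesic in a metric space $(X,d)$ is a function $g:(a,b)\cap Z_+\to X$ (the interval may be unbounded) with $\frac{|x-y|}{q}-Q\le d(g(x),g(y))\le q|x-y|+Q$ for all $x,y$ in its domain. It originates at $x_0$ if $1$ is in its domain and $g(1)=x_0$; it is a ray if its domain is $Z_+$. For $k\ge 1$, $m\ge 1$ and an integral $(k,k)$-quasi-geodesic ray $g$ with $g(1)=x_0$, the $m$-cone $C_X(x_0,k,k,g,m)$ is the set of all $x\in X$ such that $x=h(i)$ for some $i\ge m$ and some integral $(k,k)$-quasi-geodesic $h$ (possibly with finite domain) with $h(1)=x_0$ and $h(j)=g(j)$ for all $j\le m$. A function $f:X\to\mathbb{C}$ is slowly-oscillating if $|f(x_n)-f(y_n)|\to 0$ whenever $x_n\to\infty$ (i.e. $d(x_0,x_n)\to\infty$) and $d(x_n,y_n)<M$ for all $n$, for some $M>0$. A bounded continuous slowly-oscillating function $f:X\to\mathbb{C}$ is geometrically slowly-oscillating if for every $\epsilon>0$, every $k\ge1$, every $x_0\in X$ and every integral $(k,k)$-quasi-geodesic ray $g$ in $X$ originating at $x_0$ there is $m\ge 1$ such that the diameter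 of $f(C_X(x_0,k,k,g,m))$ is smaller than $\epsilon$. $C_{QG}(X)$ is the $C^*$-algebra of all geometrically slowly-oscillating functions on $X$. The quasi-geodesic compactification $X_{QG}$ is the maximal ideal space of $C_{QG}(X)$ (equivalently, the compactification of $X$ such that the functions in $C_{QG}(X)$ are exactly the restrictions to $X$ of continuous functions $X_{QG}\to\mathbb{C}$). For proper $X$, the quasi-geodesic boundary is $\partial_{QG}X:=X_{QG}\setminus X$. A geodesic ray is an isometric embedding $g:[0,\infty)\to X$; it converges to $p$ if $g(t)\to p$ in $X_{QG}$ as $t\to\infty$. *)

theory Defs
  imports "HOL-Analysis.Analysis"
begin

text \<open>
  Throughout, the metric space \<open>X\<close> is a type \<open>'a\<close> of class \<open>metric_space\<close>.
  A partial function on a set of positive integers is given by its domain \<open>D\<close> together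
  with a total function whose values outside \<open>D\<close> are irrelevant.
\<close>

definition integral_interval :: "nat set \<Rightarrow> bool" where
  "integral_interval D \<longleftrightarrow>
     (\<exists>a b :: ereal. D = {n. n \<ge> 1 \<and> a < ereal (real n) \<and> ereal (real n) < b})"

definition integral_quasi_geodesic ::
    "real \<Rightarrow> real \<Rightarrow> nat set \<Rightarrow> (nat \<Rightarrow> 'a::metric_space) \<Rightarrow> bool" where
  "integral_quasi_geodesic q Q D g \<longleftrightarrow>
     q \<ge> 1 \<and> Q \<ge> 0 \<and> integral_interval D \<and>
     (\<forall>x\<in>D. \<forall>y\<in>D.
        \<bar>real x - real y\<bar> / q - Q \<le> dist (g x) (g y) \<and>
        dist (g x) (g y) \<le> q * \<bar>real x - real y\<bar> + Q)"

definition originates_at :: "nat set \<Rightarrow> (nat \<Rightarrow> 'a::metric_space) \<Rightarrow> 'a \<Rightarrow> bool" where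
  "originates_at D g x0 \<longleftrightarrow> 1 \<in> D \<and> g 1 = x0"

abbreviation integral_quasi_geodesic_ray ::
    "real \<Rightarrow> real \<Rightarrow> (nat \<Rightarrow> 'a::metric_space) \<Rightarrow> bool" where
  "integral_quasi_geodesic_ray q Q g \<equiv> integral_quasi_geodesic q Q {1..} g"

text \<open>The cone \<open>C\<^sub>X(x\<^sub>0, q, Q, g, m)\<close>, used with \<open>q = Q = k\<close>. In it, \<open>{1..m}\<close> is contained
  in \<open>D\<close> because \<open>D\<close> is an interval containing \<open>1\<close> and \<open>i \<ge> m\<close>.\<close>

definition cone_QG ::
    "'a::metric_space \<Rightarrow> real \<Rightarrow> real \<Rightarrow> (nat \<Rightarrow> 'a) \<Rightarrow> nat \<Rightarrow> 'a set" where
  "cone_QG x0 q Q g m =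
     {x. \<exists>D h i. integral_quasi_geodesic q Q D h \<and> originates_at D h x0 \<and>
           (\<forall>j\<in>{1..m}. h j = g j) \<and> i \<in> D \<and> i \<ge> m \<and> x = h i}"

text \<open>The choice of base point is immaterial, by the triangle inequality.\<close>

definition tends_to_infinity :: "(nat \<Rightarrow> 'a::metric_space) \<Rightarrow> bool" where
  "tends_to_infinity x \<longleftrightarrow> (\<forall>x0. filterlim (\<lambda>n. dist x0 (x n)) at_top sequentially)"

definition slowly_oscillating :: "('a::metric_space \<Rightarrow> complex) \<Rightarrow> bool" where
  "slowly_oscillating f \<longleftrightarrow>
     (\<forall>x y. tends_to_infinity x \<and> (\<exists>M>0. \<forall>n. dist (x n) (y n) < M) \<longrightarrow>
        (\<lambda>n. norm (f (x n) - f (y n))) \<longlonglongrightarrow> 0)"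

definition geometrically_slowly_oscillating :: "('a::metric_space \<Rightarrow> complex) \<Rightarrow> bool" where
  "geometrically_slowly_oscillating f \<longleftrightarrow>
     bounded (range f) \<and> continuous_on UNIV f \<and> slowly_oscillating f \<and>
     (\<forall>\<epsilon>>0. \<forall>k\<ge>1. \<forall>x0 g.
        integral_quasi_geodesic_ray k k g \<and> originates_at {1..} g x0 \<longrightarrow>
        (\<exists>m\<ge>1. diameter (f ` cone_QG x0 k k g m) < \<epsilon>))"

definition C_QG :: "('a::metric_space \<Rightarrow> complex) set" where
  "C_QG = {f. geometrically_slowly_oscillating f}"

text \<open>
  The maximal ideal space of a function algebra \<open>A\<close> (with pointwise operations) in the sense of
  Gelfand: its points are the nonzero multiplicative linear functionals \<open>A \<rightarrow> \<complex>\<close>, each standing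
  for the maximal ideal that is its kernel, and its topology is that of pointwise
  convergence on \<open>A\<close>. Functionals are taken to be \<open>undefined\<close> off \<open>A\<close>, so that
  equality of functionals is equality on \<open>A\<close>.
\<close>

definition characters :: "('a \<Rightarrow> complex) set \<Rightarrow> (('a \<Rightarrow> complex) \<Rightarrow> complex) set" where
  "characters A =
     {\<phi> \<in> extensional A.
        (\<forall>f\<in>A. \<forall>g\<in>A. \<phi> (\<lambda>x. f x + g x) = \<phi> f + \<phi> g) \<and>
        (\<forall>c. \<forall>f\<in>A. \<phi> (\<lambda>x. c * f x) = c * \<phi> f) \<and>
        (\<forall>f\<in>A. \<forall>g\<in>A. \<phi> (\<lambda>x. f x * g x) = \<phi> f * \<phi> g) \<and>
        (\<exists>f\<in>A. \<phi> f \<noteq> 0)}"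

definition maximal_ideal_space ::
    "('a \<Rightarrow> complex) set \<Rightarrow> (('a \<Rightarrow> complex) \<Rightarrow> complex) topology" where
  "maximal_ideal_space A = subtopology (product_topology (\<lambda>_. euclidean) A) (characters A)"

definition X_QG :: "(('a::metric_space \<Rightarrow> complex) \<Rightarrow> complex) topology" where
  "X_QG = maximal_ideal_space C_QG"

text \<open>The canonical map \<open>X \<rightarrow> X\<^sub>Q\<^sub>G\<close>, sending a point to evaluation at that point.\<close>

definition point_QG :: "'a::metric_space \<Rightarrow> (('a \<Rightarrow> complex) \<Rightarrow> complex)" where
  "point_QG x = restrict (\<lambda>f. f x) C_QG"

definition boundary_QG :: "(('a::metric_space \<Rightarrow> complex) \<Rightarrow> complex) set" where
  "boundary_QG = topspace X_QG - range point_QG"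

definition geodesic_ray :: "(real \<Rightarrow> 'a::metric_space) \<Rightarrow> bool" where
  "geodesic_ray g \<longleftrightarrow> (\<forall>s\<ge>0. \<forall>t\<ge>0. dist (g s) (g t) = \<bar>s - t\<bar>)"

definition ray_converges_QG ::
    "(real \<Rightarrow> 'a::metric_space) \<Rightarrow> (('a \<Rightarrow> complex) \<Rightarrow> complex) \<Rightarrow> bool" where
  "ray_converges_QG g p \<longleftrightarrow> limitin X_QG (\<lambda>t. point_QG (g t)) p at_top"

definition proper_metric_space :: "'a::metric_space itself \<Rightarrow> bool" where
  "proper_metric_space _ \<longleftrightarrow> (\<forall>(x::'a) r. compact (cball x r))"

definition geodesic_metric_space :: "'a::metric_space itself \<Rightarrow> bool" where
  "geodesic_metric_space _ \<longleftrightarrow>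
     (\<forall>x y :: 'a. \<exists>\<gamma> :: real \<Rightarrow> 'a. \<gamma> 0 = x \<and> \<gamma> (dist x y) = y \<and>
        (\<forall>s\<in>{0..dist x y}. \<forall>t\<in>{0..dist x y}. dist (\<gamma> s) (\<gamma> t) = \<bar>s - t\<bar>))"

end

theory Submission
  imports Defs
begin

text \<open>
  A geodesic segment of length at least \<open>m\<close> that starts at the origin of a geodesic ray \<open>g\<close> and stays within distance
  \<open>1\<close> of \<open>g\<close> at all integer times before \<open>m\<close> ends in the \<open>m\<close>-cone around \<open>g\<close>
  (\<open>geodesic_endpoint_in_cone\<close>): replacing its samples at those times by the samples of \<open>g\<close> costs only a
  bounded additive error, so the result is an integral quasi-geodesic with constants that do not
  depend on \<open>m\<close>. Both halves of the theorem come from this observation.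

  Applied to the segments of \<open>g\<close> itself, it puts \<open>g t\<close> in the \<open>m\<close>-cone for every
  \<open>t \<ge> m\<close>. Hence \<open>f (g t)\<close> is Cauchy as \<open>t\<close> grows, for every \<open>f\<close> in the algebra, and
  \<open>f \<mapsto> lim f (g t)\<close> is a character. It is not evaluation at a point \<open>y\<close>, since a bump
  function at \<open>y\<close> vanishes far out on \<open>g\<close>.

  Conversely, a character \<open>p\<close> determines a proper filter on \<open>X\<close> along which every \<open>f\<close> in the
  algebra tends to \<open>p f\<close>; this is the density of \<open>X\<close> in its compactification. If \<open>p\<close> lies in
  the boundary then, \<open>X\<close> being proper, points go to infinity along this filter
  (\<open>boundary_character_filter_at_infinity\<close>). Segments from \<open>x\<^sub>0\<close> to these points take
  their values at time \<open>t\<close> in a fixed compact ball, so by Tychonoff's theorem they have a pointwise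
  cluster point \<open>g\<close>, which is a geodesic ray. For given \<open>f\<close> and \<open>m\<close>, some point \<open>x\<close>
  has \<open>f x\<close> close to \<open>p f\<close> and a segment close to \<open>g\<close> up to time \<open>m\<close>. Then \<open>x\<close> and the tail of \<open>g\<close>
  share the \<open>m\<close>-cone, on which \<open>f\<close> varies little, so \<open>f (g t)\<close> tends to \<open>p f\<close>.

  The compactification need not be first countable, which is why filters are used in place of
  sequences.
\<close>

section \<open>The algebra of geometrically slowly-oscillating functions\<close>

lemma C_QG_D:
  assumes "f \<in> C_QG"
  shows "bounded (range f)" "continuous_on UNIV f" "slowly_oscillating f"
  using assms by (auto simp: C_QG_def geometrically_slowly_oscillating_def)

text \<open>
  Boundedness of \<open>f\<close> matters here: the diameter of an unbounded set is a junk value, which would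
  bound no distance.
\<close>

lemma C_QG_cone_dist:
  fixes f :: "'a::metric_space \<Rightarrow> complex"
  assumes f: "f \<in> C_QG" and "\<epsilon> > 0" "k \<ge> 1"
    and "integral_quasi_geodesic_ray k k g" "originates_at {1..} g x0"
  obtains m where "m \<ge> 1"
    "\<And>x y. x \<in> cone_QG x0 k k g m \<Longrightarrow> y \<in> cone_QG x0 k k g m \<Longrightarrow> norm (f x - f y) < \<epsilon>"
proof -
  obtain m where m: "m \<ge> 1" and d: "diameter (f ` cone_QG x0 k k g m) < \<epsilon>"
    using assms unfolding C_QG_def geometrically_slowly_oscillating_def by blast
  have "bounded (f ` cone_QG x0 k k g m)"
    by (rule bounded_subset[OF C_QG_D(1)[OF f]]) auto
  then have "norm (f x - f y) < \<epsilon>" if "x \<in> cone_QG x0 k k g m" "y \<in> cone_QG x0 k k g m" for x y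
    using diameter_bounded_bound[of "f ` cone_QG x0 k k g m" "f x" "f y"] that d
    by (auto simp: dist_norm)
  with m that show thesis by blast
qed

lemma cone_QG_mono:
  assumes "m \<le> n"
  shows "cone_QG x0 q Q g n \<subseteq> cone_QG x0 q Q g m"
  using assms unfolding cone_QG_def by fastforce

text \<open>
  Every defining condition of the algebra bounds the oscillation of a function, so it
  passes to any function whose oscillation is dominated by those of two members. All closure
  properties of the algebra are instances.
\<close>

lemma C_QG_Lipschitz_combination:
  fixes f g h :: "'a::metric_space \<Rightarrow> complex"
  assumes f: "f \<in> C_QG" and g: "g \<in> C_QG" and L: "L > 0"
    and h: "\<And>x y. norm (h x - h y) \<le> L * (norm (f x - f y) + norm (g x - g y))"
  shows "h \<in> C_QG"
proof -
  have bounded: "bounded (range h)"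
  proof -
    obtain B where B: "\<And>x. norm (f x) \<le> B"
      using C_QG_D(1)[OF f] by (auto simp: bounded_iff)
    obtain C where C: "\<And>x. norm (g x) \<le> C"
      using C_QG_D(1)[OF g] by (auto simp: bounded_iff)
    obtain a :: 'a where True by blast
    have "norm (h x) \<le> norm (h a) + L * ((B + B) + (C + C))" for x
    proof -
      have "norm (f x - f a) + norm (g x - g a) \<le> (B + B) + (C + C)"
        using norm_triangle_ineq4[of "f x" "f a"] norm_triangle_ineq4[of "g x" "g a"]
          B[of x] B[of a] C[of x] C[of a] by linarith
      then have "norm (h x - h a) \<le> L * ((B + B) + (C + C))"
        using h[of x a] L by (meson mult_left_mono order_trans less_imp_le)
      then show ?thesis
        using norm_triangle_sub[of "h x" "h a"] by linarith
    qed
    then show ?thesis by (auto simp: bounded_iff)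
  qed
  have cont: "continuous_on UNIV h"
    unfolding continuous_on_def
  proof
    fix x
    have "(f \<longlongrightarrow> f x) (at x)" "(g \<longlongrightarrow> g x) (at x)"
      using C_QG_D(2)[OF f] C_QG_D(2)[OF g] by (auto simp: continuous_on_def)
    then have "((\<lambda>y. L * (norm (f y - f x) + norm (g y - g x))) \<longlongrightarrow> L * (norm (f x - f x) + norm (g x - g x))) (at x)"
      by (intro tendsto_intros)
    then have "((\<lambda>y. L * (norm (f y - f x) + norm (g y - g x))) \<longlongrightarrow> 0) (at x)" by simp
    then have "((\<lambda>y. h y - h x) \<longlongrightarrow> 0) (at x)"
      by (rule Lim_null_comparison[rotated]) (use h in auto)
    then show "(h \<longlongrightarrow> h x) (at x)" by (simp add: LIM_zero_iff)
  qed
  have slow: "slowly_oscillating h"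
    unfolding slowly_oscillating_def
  proof (intro allI impI)
    fix x y :: "nat \<Rightarrow> 'a"
    assume xy: "tends_to_infinity x \<and> (\<exists>M>0. \<forall>n. dist (x n) (y n) < M)"
    have "(\<lambda>n. norm (f (x n) - f (y n))) \<longlonglongrightarrow> 0" "(\<lambda>n. norm (g (x n) - g (y n))) \<longlonglongrightarrow> 0"
      using C_QG_D(3)[OF f] C_QG_D(3)[OF g] xy unfolding slowly_oscillating_def by blast+
    then have "(\<lambda>n. L * (norm (f (x n) - f (y n)) + norm (g (x n) - g (y n)))) \<longlonglongrightarrow> L * (0 + 0)"
      by (intro tendsto_intros)
    then have "(\<lambda>n. L * (norm (f (x n) - f (y n)) + norm (g (x n) - g (y n)))) \<longlonglongrightarrow> 0" by simp
    then show "(\<lambda>n. norm (h (x n) - h (y n))) \<longlonglongrightarrow> 0"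
      by (rule Lim_null_comparison[rotated]) (use h in auto)
  qed
  have "\<exists>m\<ge>1. diameter (h ` cone_QG x0 k k r m) < \<epsilon>"
    if "\<epsilon> > 0" "k \<ge> 1" and r: "integral_quasi_geodesic_ray k k r" "originates_at {1..} r x0"
    for \<epsilon> k x0 and r :: "nat \<Rightarrow> 'a"
  proof -
    \<comment> \<open>Two terms of size at most \<open>\<delta>\<close>, scaled by \<open>L\<close>, add up to \<open>\<epsilon> / 2\<close>, which leaves room for the strict bound.\<close>
    define \<delta> where "\<delta> = \<epsilon> / (4 * L)"
    have \<delta>: "\<delta> > 0" using \<open>\<epsilon> > 0\<close> L by (simp add: \<delta>_def)
    obtain m1 where m1: "m1 \<ge> 1" "\<And>x y. x \<in> cone_QG x0 k k r m1 \<Longrightarrow> y \<in> cone_QG x0 k k r m1 \<Longrightarrow> norm (f x - f y) < \<delta>"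
      using C_QG_cone_dist[OF f \<delta> \<open>k \<ge> 1\<close> r] by blast
    obtain m2 where m2: "m2 \<ge> 1" "\<And>x y. x \<in> cone_QG x0 k k r m2 \<Longrightarrow> y \<in> cone_QG x0 k k r m2 \<Longrightarrow> norm (g x - g y) < \<delta>"
      using C_QG_cone_dist[OF g \<delta> \<open>k \<ge> 1\<close> r] by blast
    define m where "m = max m1 m2"
    have "diameter (h ` cone_QG x0 k k r m) \<le> \<epsilon> / 2"
    proof (rule diameter_le)
      fix u v assume "u \<in> h ` cone_QG x0 k k r m" "v \<in> h ` cone_QG x0 k k r m"
      then obtain x y where xy: "u = h x" "v = h y" "x \<in> cone_QG x0 k k r m" "y \<in> cone_QG x0 k k r m"
        by blast
      then have "norm (f x - f y) < \<delta>" "norm (g x - g y) < \<delta>"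
        using m1(2) m2(2) subsetD[OF cone_QG_mono[of m1 m x0 k k r]]
          subsetD[OF cone_QG_mono[of m2 m x0 k k r]]
        by (simp_all add: m_def)
      then have "L * (norm (f x - f y) + norm (g x - g y)) \<le> L * (\<delta> + \<delta>)"
        using L by (intro mult_left_mono) auto
      also have "\<dots> = \<epsilon> / 2" using L by (simp add: \<delta>_def field_simps)
      finally show "norm (u - v) \<le> \<epsilon> / 2" using h[of x y] xy by simp
    qed (use \<open>\<epsilon> > 0\<close> in auto)
    then show ?thesis using \<open>\<epsilon> > 0\<close> m1(1) by (intro exI[of _ m]) (auto simp: m_def)
  qed
  with bounded cont slow show ?thesis
    by (auto simp: C_QG_def geometrically_slowly_oscillating_def)
qed

text \<open>
  Bump functions serve two purposes: they show that the algebra is nonempty, and they separate the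
  points of the space from limits at infinity.
\<close>

definition bump :: "'a::metric_space \<Rightarrow> 'a \<Rightarrow> complex" where
  "bump y x = of_real (max 0 (1 - dist y x))"

lemma bump_eq_0: "dist y x \<ge> 1 \<Longrightarrow> bump y x = 0"
  by (simp add: bump_def)

text \<open>
  The support is bounded, so it is eventually left by sequences tending to infinity. Deep cones
  avoid it too: a \<open>(k, k)\<close>-quasi-geodesic from \<open>x\<^sub>0\<close> is at distance at least
  \<open>(i - 1) / k - k\<close> from \<open>x\<^sub>0\<close> at time \<open>i\<close>.
\<close>

lemma bump_in_C_QG: "bump y \<in> C_QG"
proof -
  have b: "bounded (range (bump y))"
    unfolding bounded_iff by (rule exI[of _ 1]) (auto simp: bump_def)
  have c: "continuous_on UNIV (bump y)"
    unfolding bump_def by (intro continuous_intros)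
  have s: "slowly_oscillating (bump y)"
    unfolding slowly_oscillating_def
  proof (intro allI impI, elim conjE exE)
    fix x z :: "nat \<Rightarrow> 'a" and M
    assume x: "tends_to_infinity x" and M: "M > 0" "\<forall>n. dist (x n) (z n) < M"
    have "eventually (\<lambda>n. dist y (x n) \<ge> M + 1) sequentially"
      using x by (auto simp: tends_to_infinity_def filterlim_at_top)
    then have "eventually (\<lambda>n. norm (bump y (x n) - bump y (z n)) = 0) sequentially"
    proof eventually_elim
      case (elim n)
      have "dist y (z n) \<ge> 1"
        using elim M(2)[rule_format, of n] dist_triangle[of y "x n" "z n"]
        by (simp add: dist_commute)
      then show ?case using elim M(1) by (simp add: bump_eq_0)
    qed
    then show "(\<lambda>n. norm (bump y (x n) - bump y (z n))) \<longlonglongrightarrow> 0"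
      by (rule tendsto_eventually)
  qed
  have "\<exists>m\<ge>1. diameter (bump y ` cone_QG x0 k k g m) < \<epsilon>"
    if "\<epsilon> > 0" "k \<ge> 1" for \<epsilon> k x0 and g :: "nat \<Rightarrow> 'a"
  proof -
    define m where "m = Suc (nat \<lceil>k * (dist x0 y + 1 + k)\<rceil>)"
    have zero: "bump y x = 0" if x: "x \<in> cone_QG x0 k k g m" for x
    proof -
      obtain D h i where h: "integral_quasi_geodesic k k D h" "1 \<in> D" "h 1 = x0" "i \<in> D" "i \<ge> m" "x = h i"
        using x by (auto simp: cone_QG_def originates_at_def)
      have "\<bar>real i - real 1\<bar> / k - k \<le> dist (h i) (h 1)"
        using h unfolding integral_quasi_geodesic_def by blast
      moreover have "\<bar>real i - real 1\<bar> \<ge> k * (dist x0 y + 1 + k)"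
        using h(5) by (simp add: m_def) linarith
      then have "\<bar>real i - real 1\<bar> / k \<ge> dist x0 y + 1 + k"
        using \<open>k \<ge> 1\<close> by (simp add: le_divide_eq mult.commute)
      ultimately have "dist x x0 \<ge> dist x0 y + 1" using h by simp
      then have "dist y x \<ge> 1" using dist_triangle[of x x0 y] by (simp add: dist_commute)
      then show ?thesis by (rule bump_eq_0)
    qed
    have "diameter (bump y ` cone_QG x0 k k g m) \<le> 0"
      by (rule diameter_le) (auto simp: zero)
    then show ?thesis using \<open>\<epsilon> > 0\<close> by (intro exI[of _ m]) (auto simp: m_def)
  qed
  with b c s show ?thesis
    by (auto simp: C_QG_def geometrically_slowly_oscillating_def)
qed

lemma const_in_C_QG: "(\<lambda>_. c) \<in> C_QG"
  by (rule C_QG_Lipschitz_combination[OF bump_in_C_QG[of undefined] bump_in_C_QG[of undefined], of 1]) auto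

lemma add_in_C_QG:
  assumes "f \<in> C_QG" "g \<in> C_QG"
  shows "(\<lambda>x. f x + g x) \<in> C_QG"
proof (rule C_QG_Lipschitz_combination[OF assms zero_less_one])
  fix x y
  show "norm ((f x + g x) - (f y + g y)) \<le> 1 * (norm (f x - f y) + norm (g x - g y))"
    using norm_triangle_ineq[of "f x - f y" "g x - g y"] by (simp add: algebra_simps)
qed

lemma cnj_in_C_QG: "f \<in> C_QG \<Longrightarrow> (\<lambda>x. cnj (f x)) \<in> C_QG"
  by (rule C_QG_Lipschitz_combination[of f f 1])
    (auto simp flip: complex_cnj_diff)

lemma mult_in_C_QG:
  assumes "f \<in> C_QG" "g \<in> C_QG"
  shows "(\<lambda>x. f x * g x) \<in> C_QG"
proof -
  obtain B where B: "\<And>x. norm (f x) \<le> B"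
    using C_QG_D(1)[OF assms(1)] by (auto simp: bounded_iff)
  obtain C where C: "\<And>x. norm (g x) \<le> C"
    using C_QG_D(1)[OF assms(2)] by (auto simp: bounded_iff)
  define L where "L = max 1 (max B C)"
  show ?thesis
  proof (rule C_QG_Lipschitz_combination[OF assms, of L])
    show "L > 0" by (simp add: L_def)
    fix x y
    have *: "f x * g x - f y * g y = (f x - f y) * g x + f y * (g x - g y)"
      by (simp add: algebra_simps)
    have "norm (f x * g x - f y * g y) \<le> norm (f x - f y) * norm (g x) + norm (f y) * norm (g x - g y)"
      unfolding * by (metis norm_mult norm_triangle_ineq)
    also have "\<dots> \<le> norm (f x - f y) * L + L * norm (g x - g y)"
      using B[of y] C[of x] by (intro add_mono mult_mono) (auto simp: L_def)
    finally show "norm (f x * g x - f y * g y) \<le> L * (norm (f x - f y) + norm (g x - g y))"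
      by (simp add: algebra_simps)
  qed
qed

text \<open>
  Inversion is \<open>1\<close>-Lipschitz outside the open unit disc.
\<close>

lemma inverse_in_C_QG:
  assumes f: "f \<in> C_QG" and ge: "\<And>x. norm (f x) \<ge> 1"
  shows "(\<lambda>x. inverse (f x)) \<in> C_QG"
proof (rule C_QG_Lipschitz_combination[OF f f zero_less_one])
  fix x y
  have nz: "f x \<noteq> 0" "f y \<noteq> 0" using ge[of x] ge[of y] by auto
  have "norm (inverse (f x) - inverse (f y)) = norm (f x - f y) / (norm (f x) * norm (f y))"
    unfolding inverse_diff_inverse[OF nz] norm_minus_cancel norm_mult norm_inverse
    by (simp add: divide_inverse)
  also have "\<dots> \<le> norm (f x - f y) / 1"
    using mult_mono[OF ge[of x] ge[of y]] by (intro divide_left_mono) auto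
  also have "\<dots> \<le> 1 * (norm (f x - f y) + norm (f x - f y))" by simp
  finally show "norm (inverse (f x) - inverse (f y)) \<le> 1 * (norm (f x - f y) + norm (f x - f y))" .
qed

section \<open>Geodesics and cones\<close>

text \<open>
  Integral quasi-geodesics start at time \<open>1\<close>, geodesic rays at time \<open>0\<close>, whence the shift.
\<close>

definition ray_samples :: "(real \<Rightarrow> 'a) \<Rightarrow> nat \<Rightarrow> 'a" where
  "ray_samples g n = g (real n - 1)"

text \<open>
  The cones of interest carry one constant \<open>k\<close> in both the multiplicative and the additive role.
  An isometric estimate with additive error at most \<open>3\<close> fits \<open>k = 3\<close>.
\<close>

lemma distance_estimate_relax:
  fixes a d :: real
  assumes "a \<ge> 0" "a - 3 \<le> d" "d \<le> a + 2"
  shows "a / 3 - 3 \<le> d \<and> d \<le> 3 * a + 3"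
  using assms by auto

lemma ray_samples_quasi_geodesic:
  assumes "geodesic_ray g"
  shows "integral_quasi_geodesic_ray 3 3 (ray_samples g)" "originates_at {1..} (ray_samples g) (g 0)"
proof -
  have "integral_interval {1..}"
    unfolding integral_interval_def by (rule exI[of _ 0], rule exI[of _ \<infinity>]) auto
  moreover have "\<bar>real x - real y\<bar> / 3 - 3 \<le> dist (ray_samples g x) (ray_samples g y) \<and>
      dist (ray_samples g x) (ray_samples g y) \<le> 3 * \<bar>real x - real y\<bar> + 3"
    if "x \<in> {1..}" "y \<in> {1..}" for x y
  proof -
    have "dist (ray_samples g x) (ray_samples g y) = \<bar>real x - real y\<bar>"
      using assms that by (simp add: ray_samples_def geodesic_ray_def)
    then show ?thesis by (intro distance_estimate_relax) simp_all
  qed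
  ultimately show "integral_quasi_geodesic_ray 3 3 (ray_samples g)"
    unfolding integral_quasi_geodesic_def by simp
  show "originates_at {1..} (ray_samples g) (g 0)"
    by (simp add: originates_at_def ray_samples_def)
qed

text \<open>
  The quasi-geodesic reaching \<open>\<gamma> L\<close> follows \<open>g\<close> for \<open>m\<close> steps and \<open>\<gamma>\<close> afterwards. Its
  distances differ from those of \<open>\<gamma>\<close> by at most \<open>1\<close> at each end, and cutting off the time at
  \<open>L\<close>, so that the endpoint is attained even if \<open>L\<close> is not an integer, costs at most \<open>1\<close> more.
\<close>

lemma geodesic_endpoint_in_cone:
  fixes g \<gamma> :: "real \<Rightarrow> 'a::metric_space"
  assumes \<gamma>: "\<And>s t. s \<in> {0..L} \<Longrightarrow> t \<in> {0..L} \<Longrightarrow> dist (\<gamma> s) (\<gamma> t) = \<bar>s - t\<bar>"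
    and m: "m \<ge> 1" "real m \<le> L"
    and near: "\<And>j. j < m \<Longrightarrow> dist (\<gamma> (real j)) (g (real j)) \<le> 1"
  shows "\<gamma> L \<in> cone_QG (g 0) 3 3 (ray_samples g) m"
proof -
  \<comment> \<open>At step \<open>N\<close> the shifted time \<open>N - 1\<close> first reaches \<open>L\<close>; the cut-off time \<open>u N\<close> is exactly \<open>L\<close>.\<close>
  define N where "N = Suc (nat \<lceil>L\<rceil>)"
  define u where "u = (\<lambda>j::nat. min (real j - 1) L)"
  define h where "h = (\<lambda>j. if j \<le> m then g (real j - 1) else \<gamma> (u j))"
  have L0: "L \<ge> 0" using m by linarith
  have N: "real N - 1 \<ge> L" "real N - 1 < L + 1" "N > m"
    using m L0 by (simp_all add: N_def) linarith+
  have near_u: "dist (h j) (\<gamma> (u j)) \<le> 1" if "j \<ge> 1" for j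
  proof (cases "j \<le> m")
    case True
    then have "u j = real (j - 1)" using m that by (simp add: u_def)
    then show ?thesis using near[of "j - 1"] True that by (simp add: h_def dist_commute)
  qed (simp add: h_def)
  have interval: "integral_interval {1..N}"
    unfolding integral_interval_def
    by (rule exI[of _ 0], rule exI[of _ "ereal (real (Suc N))"]) auto
  have est: "\<bar>real i - real j\<bar> - 3 \<le> dist (h i) (h j) \<and> dist (h i) (h j) \<le> \<bar>real i - real j\<bar> + 2"
    if ij: "i \<in> {1..N}" "j \<in> {1..N}" for i j
  proof -
    have u: "u i \<in> {0..L}" "u j \<in> {0..L}" using ij L0 by (auto simp: u_def)
    have d: "dist (\<gamma> (u i)) (\<gamma> (u j)) = \<bar>u i - u j\<bar>" by (rule \<gamma>[OF u])
    have ui: "real i - 2 \<le> u i" "real j - 2 \<le> u j"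
      using ij N by (auto simp: u_def)
    have "\<bar>u i - u j\<bar> \<le> \<bar>real i - real j\<bar>" by (auto simp: u_def min_def)
    moreover have "\<bar>real i - real j\<bar> - 1 \<le> \<bar>u i - u j\<bar>"
      using ui by (auto simp: u_def min_def)
    moreover have "dist (h i) (h j) \<le> dist (h i) (\<gamma> (u i)) + dist (\<gamma> (u i)) (\<gamma> (u j)) + dist (h j) (\<gamma> (u j))"
      using dist_triangle[of "h i" "h j" "\<gamma> (u i)"] dist_triangle[of "\<gamma> (u i)" "h j" "\<gamma> (u j)"]
      by (simp add: dist_commute)
    moreover have "dist (\<gamma> (u i)) (\<gamma> (u j)) \<le> dist (h i) (\<gamma> (u i)) + dist (h i) (h j) + dist (h j) (\<gamma> (u j))"
      using dist_triangle[of "\<gamma> (u i)" "\<gamma> (u j)" "h i"] dist_triangle[of "h i" "\<gamma> (u j)" "h j"]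
      by (simp add: dist_commute)
    moreover have "dist (h i) (\<gamma> (u i)) \<le> 1" "dist (h j) (\<gamma> (u j)) \<le> 1"
      using near_u ij by auto
    ultimately show ?thesis using d by linarith
  qed
  have "\<bar>real i - real j\<bar> / 3 - 3 \<le> dist (h i) (h j) \<and> dist (h i) (h j) \<le> 3 * \<bar>real i - real j\<bar> + 3"
    if "i \<in> {1..N}" "j \<in> {1..N}" for i j
    using est[OF that] by (intro distance_estimate_relax) simp_all
  then have "integral_quasi_geodesic 3 3 {1..N} h"
    unfolding integral_quasi_geodesic_def using interval by simp
  moreover have "originates_at {1..N} h (g 0)"
    using m N by (simp add: originates_at_def h_def)
  moreover have "\<forall>j\<in>{1..m}. h j = ray_samples g j" by (simp add: h_def ray_samples_def)
  moreover have "\<gamma> L = h N" using N by (simp add: h_def u_def)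
  moreover have "N \<in> {1..N}" "m \<le> N" using N by auto
  ultimately show ?thesis unfolding cone_QG_def by blast
qed

lemma geodesic_ray_in_cone:
  assumes "geodesic_ray g" "m \<ge> 1" "real m \<le> t"
  shows "g t \<in> cone_QG (g 0) 3 3 (ray_samples g) m"
  using assms by (intro geodesic_endpoint_in_cone) (auto simp: geodesic_ray_def)

section \<open>Convergence in the compactification\<close>

lemma topspace_X_QG: "topspace X_QG = characters C_QG"
  by (auto simp: X_QG_def maximal_ideal_space_def characters_def PiE_def)

lemma point_QG_character: "point_QG x \<in> characters C_QG"
  using const_in_C_QG[of 1] mult_in_C_QG[OF const_in_C_QG]
  by (auto simp: characters_def point_QG_def add_in_C_QG mult_in_C_QG intro!: bexI[of _ "\<lambda>_. 1"])

lemma ray_converges_QG_iff: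
  assumes "p \<in> characters C_QG"
  shows "ray_converges_QG g p \<longleftrightarrow> (\<forall>f\<in>C_QG. ((\<lambda>t. f (g t)) \<longlongrightarrow> p f) at_top)"
  using assms point_QG_character[of "g _"]
  unfolding ray_converges_QG_def X_QG_def maximal_ideal_space_def
  by (simp add: limitin_subtopology limitin_componentwise)
    (auto simp: characters_def point_QG_def)

lemma C_QG_convergent_along_ray:
  fixes g :: "real \<Rightarrow> 'a::metric_space"
  assumes g: "geodesic_ray g" and f: "f \<in> C_QG"
  shows "\<exists>l. ((\<lambda>t. f (g t)) \<longlongrightarrow> l) at_top"
proof -
  have "cauchy_filter (filtermap (\<lambda>t. f (g t)) at_top)"
    unfolding cauchy_filter_metric_filtermap
  proof (intro allI impI)
    fix e :: real assume "e > 0"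
    obtain m where m: "m \<ge> 1" "\<And>x y. x \<in> cone_QG (g 0) 3 3 (ray_samples g) m \<Longrightarrow>
        y \<in> cone_QG (g 0) 3 3 (ray_samples g) m \<Longrightarrow> norm (f x - f y) < e"
      using C_QG_cone_dist[OF f \<open>e > 0\<close> _ ray_samples_quasi_geodesic[OF g]] by auto
    have "eventually (\<lambda>t. real m \<le> t) at_top" by (rule eventually_ge_at_top)
    moreover have "\<forall>x y. real m \<le> x \<and> real m \<le> y \<longrightarrow> dist (f (g x)) (f (g y)) < e"
      using m geodesic_ray_in_cone[OF g m(1)] by (auto simp: dist_norm)
    ultimately show "\<exists>P. eventually P at_top \<and> (\<forall>x y. P x \<and> P y \<longrightarrow> dist (f (g x)) (f (g y)) < e)"
      by blast
  qed
  then obtain l where "filtermap (\<lambda>t. f (g t)) at_top \<le> nhds l"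
    using complete_uniform[of "UNIV :: complex set"] complete_UNIV
    by (metis UNIV_I filtermap_bot_iff principal_UNIV top_greatest trivial_limit_at_top_linorder)
  then show ?thesis by (auto simp: filterlim_def)
qed

lemma geodesic_ray_converges_QG:
  fixes g :: "real \<Rightarrow> 'a::metric_space"
  assumes g: "geodesic_ray g"
  shows "\<exists>p\<in>boundary_QG. ray_converges_QG g p"
proof -
  obtain l where l: "\<And>f. f \<in> C_QG \<Longrightarrow> ((\<lambda>t. f (g t)) \<longlongrightarrow> l f) at_top"
    using C_QG_convergent_along_ray[OF g] by metis
  define p where "p = restrict l C_QG"
  have p: "((\<lambda>t. f (g t)) \<longlongrightarrow> p f) at_top" if "f \<in> C_QG" for f
    using l[OF that] that by (simp add: p_def)
  have unique: "p f = c" if "f \<in> C_QG" "((\<lambda>t. f (g t)) \<longlongrightarrow> c) at_top" for f c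
    using tendsto_unique[OF _ p[OF that(1)] that(2)] by simp
  have "p \<in> characters C_QG"
    unfolding characters_def
  proof (safe)
    show "p \<in> extensional C_QG" by (simp add: p_def)
    show "p (\<lambda>x. f x + h x) = p f + p h" if "f \<in> C_QG" "h \<in> C_QG" for f h
      by (rule unique[OF add_in_C_QG[OF that]]) (intro tendsto_intros p that)
    show "p (\<lambda>x. f x * h x) = p f * p h" if "f \<in> C_QG" "h \<in> C_QG" for f h
      by (rule unique[OF mult_in_C_QG[OF that]]) (intro tendsto_intros p that)
    show "p (\<lambda>x. c * f x) = c * p f" if "f \<in> C_QG" for f c
      by (rule unique[OF mult_in_C_QG[OF const_in_C_QG that]]) (intro tendsto_intros p that)
    show "\<exists>f\<in>C_QG. p f \<noteq> 0"
      using unique[OF const_in_C_QG, of 1 1] by (intro bexI[OF _ const_in_C_QG[of 1]]) auto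
  qed
  moreover have "p \<noteq> point_QG y" for y
  proof
    assume eq: "p = point_QG y"
    \<comment> \<open>From time \<open>1 + dist y (g 0)\<close> on, the ray is outside the support of the bump at \<open>y\<close>.\<close>
    have "eventually (\<lambda>t. t \<ge> 1 + dist y (g 0)) at_top" by (rule eventually_ge_at_top)
    then have "eventually (\<lambda>t. bump y (g t) = 0) at_top"
    proof eventually_elim
      case (elim t)
      have "t \<ge> 0" using elim zero_le_dist[of y "g 0"] by linarith
      then have "dist (g 0) (g t) = t" using g by (simp add: geodesic_ray_def)
      then have "dist y (g t) \<ge> 1"
        using elim dist_triangle[of "g 0" "g t" y] by (simp add: dist_commute)
      then show ?case by (rule bump_eq_0)
    qed
    then have "p (bump y) = 0"
      by (intro unique bump_in_C_QG tendsto_eventually)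
    then show False using eq bump_in_C_QG[of y] by (simp add: point_QG_def bump_def)
  qed
  ultimately have "p \<in> boundary_QG" by (auto simp: boundary_QG_def topspace_X_QG)
  then show ?thesis using ray_converges_QG_iff[OF \<open>p \<in> characters C_QG\<close>] p by blast
qed

section \<open>Points of the boundary as limits along filters on the space\<close>

definition kernel_QG :: "(('a::metric_space \<Rightarrow> complex) \<Rightarrow> complex) \<Rightarrow> ('a \<Rightarrow> complex) set" where
  "kernel_QG p = {\<phi> \<in> C_QG. p \<phi> = 0}"

text \<open>
  This is the trace on the space of the neighbourhoods of \<open>p\<close> in the compactification. The
  threshold \<open>1\<close> loses nothing, because the kernel is closed under multiplication by scalars.
\<close>

definition character_filter :: "(('a::metric_space \<Rightarrow> complex) \<Rightarrow> complex) \<Rightarrow> 'a filter" where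
  "character_filter p = (INF \<phi>\<in>kernel_QG p. principal {x. norm (\<phi> x) < 1})"

context
  fixes p :: "('a::metric_space \<Rightarrow> complex) \<Rightarrow> complex"
  assumes p: "p \<in> characters C_QG"
begin

lemma character_add: "f \<in> C_QG \<Longrightarrow> g \<in> C_QG \<Longrightarrow> p (\<lambda>x. f x + g x) = p f + p g"
  and character_scale: "f \<in> C_QG \<Longrightarrow> p (\<lambda>x. c * f x) = c * p f"
  and character_mult: "f \<in> C_QG \<Longrightarrow> g \<in> C_QG \<Longrightarrow> p (\<lambda>x. f x * g x) = p f * p g"
  using p by (auto simp: characters_def)

lemma character_one: "p (\<lambda>_. 1) = 1"
proof -
  obtain f where "f \<in> C_QG" "p f \<noteq> 0" using p by (auto simp: characters_def)
  then show ?thesis using character_mult[of f "\<lambda>_. 1"] const_in_C_QG[of 1] by simp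
qed

lemma character_const: "p (\<lambda>_. c) = c"
  using character_scale[OF const_in_C_QG[of 1], of c] character_one by simp

text \<open>
  The generating sets form a filter base: for \<open>\<phi>\<close> and \<open>\<psi>\<close> in the kernel, so is
  \<open>\<bar>\<phi>\<bar>\<^sup>2 + \<bar>\<psi>\<bar>\<^sup>2\<close>, and where it is below \<open>1\<close> both moduli are. Closure of the algebra under
  conjugation enters at this point.
\<close>

lemma eventually_character_filter:
  "eventually P (character_filter p) \<longleftrightarrow> (\<exists>\<phi>\<in>kernel_QG p. \<forall>x. norm (\<phi> x) < 1 \<longrightarrow> P x)"
  unfolding character_filter_def
proof (subst eventually_INF_base)
  show "kernel_QG p \<noteq> {}"
    using character_const[of 0] const_in_C_QG[of 0] by (auto simp: kernel_QG_def)
next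
  fix \<phi> \<psi> assume \<phi>: "\<phi> \<in> kernel_QG p" and \<psi>: "\<psi> \<in> kernel_QG p"
  define \<theta> where "\<theta> = (\<lambda>x. \<phi> x * cnj (\<phi> x) + \<psi> x * cnj (\<psi> x))"
  have "\<theta> \<in> kernel_QG p"
    using \<phi> \<psi> unfolding \<theta>_def kernel_QG_def
    by (simp add: add_in_C_QG mult_in_C_QG cnj_in_C_QG character_add character_mult)
  moreover have "norm (\<phi> x) < 1 \<and> norm (\<psi> x) < 1" if "norm (\<theta> x) < 1" for x
  proof -
    have "\<theta> x = of_real ((norm (\<phi> x))\<^sup>2 + (norm (\<psi> x))\<^sup>2)"
      by (simp add: \<theta>_def complex_norm_square[symmetric])
    then have "norm (\<theta> x) = (norm (\<phi> x))\<^sup>2 + (norm (\<psi> x))\<^sup>2"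
      by (simp only: norm_of_real) simp
    then have "(norm (\<phi> x))\<^sup>2 < 1" "(norm (\<psi> x))\<^sup>2 < 1"
      using that zero_le_power2[of "norm (\<phi> x)"] zero_le_power2[of "norm (\<psi> x)"] by linarith+
    then show ?thesis by (simp add: power_less_one_iff abs_square_less_1)
  qed
  ultimately show "\<exists>\<theta>\<in>kernel_QG p. principal {x. norm (\<theta> x) < 1}
      \<le> inf (principal {x. norm (\<phi> x) < 1}) (principal {x. norm (\<psi> x) < 1})"
    by (intro bexI[of _ \<theta>]) auto
qed (simp add: eventually_principal)

text \<open>
  An element \<open>\<phi>\<close> of the kernel with \<open>\<bar>\<phi>\<bar> \<ge> 1\<close> everywhere would be invertible in the
  algebra, and no invertible element is in the kernel of a character.
\<close>

lemma character_filter_neq_bot: "character_filter p \<noteq> bot"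
proof
  assume "character_filter p = bot"
  then have "eventually (\<lambda>_. False) (character_filter p)" by simp
  then obtain \<phi> where \<phi>: "\<phi> \<in> C_QG" "p \<phi> = 0" and ge: "\<And>x. norm (\<phi> x) \<ge> 1"
    unfolding eventually_character_filter by (auto simp: kernel_QG_def not_less)
  have "\<phi> x \<noteq> 0" for x using ge[of x] by auto
  then have "(\<lambda>x. \<phi> x * inverse (\<phi> x)) = (\<lambda>_. 1)" by auto
  then show False
    using character_mult[OF \<phi>(1) inverse_in_C_QG[OF \<phi>(1) ge]] \<phi>(2) character_one by simp
qed

lemma C_QG_tendsto_character:
  assumes f: "f \<in> C_QG"
  shows "(f \<longlongrightarrow> p f) (character_filter p)"
proof (rule tendstoI)
  fix e :: real assume "e > 0"
  define \<phi> where "\<phi> = (\<lambda>x. of_real (1 / e) * (f x + (- p f)))"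
  have "\<phi> \<in> kernel_QG p"
    using f unfolding \<phi>_def kernel_QG_def
    by (simp only: mem_Collect_eq character_scale character_add character_const
        add_in_C_QG const_in_C_QG mult_in_C_QG) simp
  moreover have "dist (f x) (p f) < e" if "norm (\<phi> x) < 1" for x
    using that \<open>e > 0\<close> by (simp add: \<phi>_def dist_norm norm_mult norm_divide field_simps)
  ultimately show "eventually (\<lambda>x. dist (f x) (p f) < e) (character_filter p)"
    unfolding eventually_character_filter by blast
qed

text \<open>
  Otherwise the filter meets a compact ball and has a cluster point \<open>y\<close> there. By continuity
  \<open>p\<close> agrees with evaluation at \<open>y\<close>, contrary to the assumption.
\<close>

lemma boundary_character_filter_at_infinity:
  assumes proper: "proper_metric_space TYPE('a)" and nonpoint: "p \<notin> range point_QG"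
  shows "eventually (\<lambda>x. dist x0 x > R) (character_filter p)"
proof (rule ccontr)
  let ?K = "inf (character_filter p) (principal (cball x0 R))"
  assume "\<not> ?thesis"
  then have "?K \<noteq> bot"
    by (simp add: trivial_limit_def eventually_inf_principal not_le)
  moreover have "eventually (\<lambda>x. x \<in> cball x0 R) ?K" by (simp add: eventually_inf_principal)
  moreover have "compact (cball x0 R)" using proper by (simp add: proper_metric_space_def)
  ultimately obtain y where y: "inf (nhds y) ?K \<noteq> bot"
    unfolding compact_filter by blast
  have "p f = f y" if f: "f \<in> C_QG" for f
  proof (rule tendsto_unique[OF y])
    show "(f \<longlongrightarrow> p f) (inf (nhds y) ?K)"
      by (rule tendsto_mono[OF _ C_QG_tendsto_character[OF f]]) (simp add: le_infI1 le_infI2)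
    have "(f \<longlongrightarrow> f y) (nhds y)"
      using C_QG_D(2)[OF f] by (simp add: continuous_on_def tendsto_at_iff_tendsto_nhds)
    then show "(f \<longlongrightarrow> f y) (inf (nhds y) ?K)" by (rule tendsto_mono[rotated]) simp
  qed
  moreover have "p \<in> extensional C_QG" using p by (simp add: characters_def)
  ultimately have "p = point_QG y"
    by (intro extensionalityI[of p C_QG]) (auto simp: point_QG_def)
  with nonpoint show False by blast
qed

end

section \<open>Rays as cluster points of geodesic segments\<close>

lemma compact_pointwise_bounded_functions:
  fixes a :: "'i \<Rightarrow> 'a::metric_space"
  assumes "proper_metric_space TYPE('a)"
  shows "compact {g. \<forall>t. g t \<in> cball (a t) (r t)}"
proof -
  have "compactin (product_topology (\<lambda>_. euclidean) UNIV) (PiE UNIV (\<lambda>t. cball (a t) (r t)))"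
    using assms by (simp add: compactin_PiE proper_metric_space_def)
  moreover have "PiE UNIV (\<lambda>t. cball (a t) (r t)) = {g. \<forall>t. g t \<in> cball (a t) (r t)}"
    by (auto simp: PiE_def Pi_def)
  ultimately show ?thesis by (simp add: euclidean_product_topology)
qed

lemma boundary_point_limit_of_ray:
  fixes x0 :: "'a::metric_space"
  assumes proper: "proper_metric_space TYPE('a)" and geodesic: "geodesic_metric_space TYPE('a)"
    and boundary: "p \<in> boundary_QG"
  shows "\<exists>g. geodesic_ray g \<and> g 0 = x0 \<and> ray_converges_QG g p"
proof -
  have p: "p \<in> characters C_QG" and nonpoint: "p \<notin> range point_QG"
    using boundary by (auto simp: boundary_QG_def topspace_X_QG)
  let ?F = "character_filter p"
  have "\<forall>x. \<exists>\<gamma>. \<gamma> 0 = x0 \<and> \<gamma> (dist x0 x) = x \<and>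
      (\<forall>s\<in>{0..dist x0 x}. \<forall>t\<in>{0..dist x0 x}. dist (\<gamma> s) (\<gamma> t) = \<bar>s - t\<bar>)"
    using geodesic unfolding geodesic_metric_space_def by blast
  then obtain \<gamma> where \<gamma>0: "\<And>x. \<gamma> x 0 = x0" and \<gamma>1: "\<And>x. \<gamma> x (dist x0 x) = x"
    and \<gamma>: "\<And>x s t. s \<in> {0..dist x0 x} \<Longrightarrow> t \<in> {0..dist x0 x} \<Longrightarrow> dist (\<gamma> x s) (\<gamma> x t) = \<bar>s - t\<bar>"
    by metis
  \<comment> \<open>\<open>G x\<close> is the segment to \<open>x\<close>, extended by constants to a function on the whole line, so
      that all segments live in one product space.\<close>
  define G where "G = (\<lambda>x t. \<gamma> x (max 0 (min t (dist x0 x))))"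
  define K where "K = {g :: real \<Rightarrow> 'a. \<forall>t. g t \<in> cball x0 \<bar>t\<bar>}"
  have "compact K"
    unfolding K_def by (rule compact_pointwise_bounded_functions[OF proper])
  moreover have "G x \<in> K" for x
  proof -
    have "dist x0 (G x t) = \<bar>max 0 (min t (dist x0 x))\<bar>" for t
      using \<gamma>[of 0 x "max 0 (min t (dist x0 x))"] by (simp add: G_def \<gamma>0)
    then show ?thesis by (auto simp: K_def)
  qed
  then have "eventually (\<lambda>g. g \<in> K) (filtermap G ?F)" by (simp add: eventually_filtermap)
  moreover have "filtermap G ?F \<noteq> bot"
    using character_filter_neq_bot[OF p] by (simp add: filtermap_bot_iff)
  ultimately obtain g where g: "inf (nhds g) (filtermap G ?F) \<noteq> bot"
    unfolding compact_filter by blast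
  \<comment> \<open>Refining the filter so that the segments converge to their cluster point plays the role of
      passing to a subnet.\<close>
  define H where "H = inf ?F (filtercomap G (nhds g))"
  have H: "H \<noteq> bot"
  proof
    assume "H = bot"
    then have "eventually (\<lambda>_. False) H" by simp
    then obtain P Q where PQ: "eventually P ?F" "eventually Q (nhds g)" "\<And>x. P x \<Longrightarrow> Q (G x) \<Longrightarrow> False"
      unfolding H_def eventually_inf eventually_filtercomap by blast
    have "eventually (\<lambda>h. \<not> Q h) (filtermap G ?F)"
      unfolding eventually_filtermap using PQ(1) by eventually_elim (use PQ(3) in blast)
    then have "eventually (\<lambda>_. False) (inf (nhds g) (filtermap G ?F))"
      unfolding eventually_inf using PQ(2) by blast
    then show False using g by (simp add: trivial_limit_def)
  qed
  have "(G \<longlongrightarrow> g) H"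
    unfolding H_def by (rule filterlim_mono[OF filterlim_filtercomap]) auto
  then have lim: "((\<lambda>x. G x t) \<longlongrightarrow> g t) H" for t
    using continuous_on_tendsto_compose[OF continuous_on_product_coordinates[of t], of G g H] by simp
  have FH: "eventually P H" if "eventually P ?F" for P
    by (rule filter_leD[OF _ that]) (simp add: H_def)
  have infinity: "eventually (\<lambda>x. dist x0 x > R) H" for R
    by (rule FH[OF boundary_character_filter_at_infinity[OF p proper nonpoint]])
  \<comment> \<open>Fixed times \<open>s\<close> and \<open>t\<close> eventually lie in the domains of the segments, where distances are
      exact.\<close>
  have ray: "geodesic_ray g"
    unfolding geodesic_ray_def
  proof (intro allI impI)
    fix s t :: real assume st: "s \<ge> 0" "t \<ge> 0"
    have "eventually (\<lambda>x. dist (G x s) (G x t) = \<bar>s - t\<bar>) H"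
      using infinity[of "max s t"] by eventually_elim (use st \<gamma> in \<open>auto simp: G_def\<close>)
    then have "((\<lambda>x. dist (G x s) (G x t)) \<longlongrightarrow> \<bar>s - t\<bar>) H" by (rule tendsto_eventually)
    then show "dist (g s) (g t) = \<bar>s - t\<bar>"
      using tendsto_unique[OF H tendsto_dist[OF lim lim]] by blast
  qed
  have g0: "g 0 = x0"
  proof -
    have "G x 0 = x0" for x by (simp add: G_def \<gamma>0)
    then show ?thesis using tendsto_unique[OF H lim[of 0]] by simp
  qed
  have "((\<lambda>t. f (g t)) \<longlongrightarrow> p f) at_top" if f: "f \<in> C_QG" for f
  proof (rule tendstoI)
    fix e :: real assume "e > 0"
    then have e2: "e / 2 > 0" by simp
    obtain m where m: "m \<ge> 1" "\<And>x y. x \<in> cone_QG (g 0) 3 3 (ray_samples g) m \<Longrightarrow>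
        y \<in> cone_QG (g 0) 3 3 (ray_samples g) m \<Longrightarrow> norm (f x - f y) < e / 2"
      using C_QG_cone_dist[OF f e2 _ ray_samples_quasi_geodesic[OF ray]] by auto
    have "eventually (\<lambda>x. \<forall>j\<in>{..<m}. dist (G x (real j)) (g (real j)) < 1) H"
      by (intro eventually_ball_finite ballI tendstoD[OF lim]) auto
    moreover have "eventually (\<lambda>x. dist (f x) (p f) < e / 2) H"
      by (intro FH tendstoD[OF C_QG_tendsto_character[OF p f]] e2)
    ultimately have "eventually (\<lambda>x. (\<forall>j\<in>{..<m}. dist (G x (real j)) (g (real j)) < 1) \<and>
        dist (f x) (p f) < e / 2 \<and> dist x0 x > real m) H"
      using infinity[of "real m"] by eventually_elim auto
    then obtain x where x: "\<forall>j\<in>{..<m}. dist (G x (real j)) (g (real j)) < 1"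
        "dist (f x) (p f) < e / 2" "dist x0 x > real m"
      using eventually_happens'[OF H] by blast
    have "\<gamma> x (dist x0 x) \<in> cone_QG (g 0) 3 3 (ray_samples g) m"
    proof (rule geodesic_endpoint_in_cone[OF \<gamma> m(1)])
      fix j assume "j < m"
      then show "dist (\<gamma> x (real j)) (g (real j)) \<le> 1"
        using x(1)[rule_format, of j] x(3) by (simp add: G_def)
    qed (use x in auto)
    then have x_cone: "x \<in> cone_QG (g 0) 3 3 (ray_samples g) m" by (simp add: \<gamma>1)
    have "eventually (\<lambda>t. t \<ge> real m) at_top" by (rule eventually_ge_at_top)
    then show "eventually (\<lambda>t. dist (f (g t)) (p f) < e) at_top"
    proof eventually_elim
      case (elim t)
      have "dist (f (g t)) (f x) < e / 2"
        using m(2)[OF geodesic_ray_in_cone[OF ray m(1) elim] x_cone] by (simp add: dist_norm)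
      then show ?case using x(2) dist_triangle[of "f (g t)" "p f" "f x"] by linarith
    qed
  qed
  then have "ray_converges_QG g p" using ray_converges_QG_iff[OF p] by blast
  with ray g0 show ?thesis by blast
qed

theorem corollary4p7:
  assumes "proper_metric_space TYPE('a::metric_space)"
    and "geodesic_metric_space TYPE('a)"
  shows "(\<forall>g :: real \<Rightarrow> 'a. geodesic_ray g \<longrightarrow> (\<exists>p\<in>boundary_QG. ray_converges_QG g p)) \<and>
         (\<forall>(x0::'a) p. p \<in> boundary_QG \<longrightarrow>
            (\<exists>g. geodesic_ray g \<and> g 0 = x0 \<and> ray_converges_QG g p))"
  using geodesic_ray_converges_QG boundary_point_limit_of_ray[OF assms] by blast

end
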